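(* Let $\Phi\in\mathbb{R}^{d\times N}$ and $\Phi^*\in\mathbb{R}^{d\times N^*}$ with $N,N^*\ge 1$, and let $X=[\Phi,\Phi^*]\in\mathbb{R}^{d\times d'}$, $d'=N+N^*$, be their column-wise concatenation. Assume that $X^TX$ is positive definite. Let $P=(X^TX)^{-1/2}X^T\in\mathbb{R}^{d'\times d}$ and, for any matrix $A$ with $d$ rows, let $\Pi(A)=PA$. Then: (a) $\Pi(X)=(X^TX)^{1/2}$. (b) $\Pi$ is isometric on the columns of $X$: writing $x_1,\dots,x_{d'}$ for the columns of $X$, we have $\|\Pi(x_i)-\Pi(x_j)\|_2=\|x_i-x_j\|_2$ for all $i,j\in\{1,\dots,d'\}$. (c) For every $\varepsilon>0$ and for each $d_g^2$ among the squared Frobenius distance, the squared affine-invariant Riemannian distance (AIRM) and the Jensen-Bregman LogDet divergence (JBLD), $$d_g^2\big(\Sigma_\varepsilon(\Phi),\Sigma_\varepsilon(\Phi^* )\big)=d_g^2\big(\Sigma_\varepsilon(\Pi(\Phi)),\Sigma_\varepsilon(\Pi(\Phi^* ))\big),$$ where the left-hand side is evaluated on $d\times d$ matrices and the right-hand side on $d'\times d'$ matrices.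
   Context: For a matrix $A=[a_1,\dots,a_M]\in\mathbb{R}^{p\times M}$ with columns $a_n$, the mean is $\mu(A)=\frac1M\sum_{n=1}^M a_n$, the covariance (scatter) matrix is $\Sigma(A)=\frac1M\sum_{n=1}^M a_na_n^T-\mu(A)\mu(A)^T\in\mathbb{R}^{p\times p}$, and the regularized covariance is $\Sigma_\varepsilon(A)=\Sigma(A)+\varepsilon I_p$ with $\varepsilon>0$. For a positive definite matrix $M$, $M^{1/2}$ is its positive definite square root and $M^{-1/2}$ the inverse of that root. $\|\cdot\|_F$ is the Frobenius norm, $|\cdot|$ applied to a matrix is the determinant, and $\log$ of a positive definite matrix is the principal (symmetric) matrix logarithm. For symmetric positive definite matrices $S,S^*$ of equal size: - Frobenius: $d_g^2(S,S^* )=\|S-S^*\|_F^2$; - AIRM: $d_g^2(S,S^* )=\|\log(S^{-1/2}S^*S^{-1/2})\|_F^2$; - JBLD: $d_g^2(S,S^* )=\log\left|\frac{S+S^*}{2}\right|-\frac12\log|SS^*|$. *)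

theory Defs
  imports "HOL-Analysis.Analysis"
begin

text \<open>
  A \<open>p \<times> M\<close> matrix has type \<^typ>\<open>real^'m^'p\<close> (outer index: rows). The index types are finite and
  nonempty, so all dimensions are at least 1. On these types \<^const>\<open>norm\<close> is the Frobenius norm
  and \<open>*\<close>, \<open>^\<close>, \<open>1\<close> are componentwise; matrix operations are \<open>**\<close>, \<open>*v\<close> and \<open>mat 1\<close>.
\<close>

subsection \<open>Means, covariances and concatenation\<close>

definition outer_product :: "real^'p \<Rightarrow> real^'p \<Rightarrow> real^'p^'p" where
  "outer_product u v = (\<chi> i j. u $ i * v $ j)"

definition col_mean :: "real^'m^'p \<Rightarrow> real^'p" where
  "col_mean A = (1 / real CARD('m)) *\<^sub>R (\<Sum>n\<in>UNIV. column n A)"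

definition covariance :: "real^'m^'p \<Rightarrow> real^'p^'p" where
  "covariance A =
     (1 / real CARD('m)) *\<^sub>R (\<Sum>n\<in>UNIV. outer_product (column n A) (column n A))
     - outer_product (col_mean A) (col_mean A)"

definition reg_covariance :: "real \<Rightarrow> real^'m^'p \<Rightarrow> real^'p^'p" where
  "reg_covariance \<epsilon> A = covariance A + \<epsilon> *\<^sub>R mat 1"

text \<open>The columns of \<open>[A, B]\<close> are indexed by the disjoint sum of the two column index types.\<close>

definition hconcat :: "real^'n^'d \<Rightarrow> real^'m^'d \<Rightarrow> real^('n + 'm)^'d" where
  "hconcat A B = (\<chi> i j. case j of Inl k \<Rightarrow> A $ i $ k | Inr k \<Rightarrow> B $ i $ k)"

subsection \<open>Positive definite matrices, square root and logarithm\<close>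

definition symmetric_mat :: "real^'n^'n \<Rightarrow> bool" where
  "symmetric_mat A \<longleftrightarrow> transpose A = A"

definition pos_def :: "real^'n^'n \<Rightarrow> bool" where
  "pos_def A \<longleftrightarrow> symmetric_mat A \<and> (\<forall>x. x \<noteq> 0 \<longrightarrow> 0 < x \<bullet> (A *v x))"

definition mat_sqrt :: "real^'n^'n \<Rightarrow> real^'n^'n" where
  "mat_sqrt A = (THE R. pos_def R \<and> R ** R = A)"

definition mat_inv_sqrt :: "real^'n^'n \<Rightarrow> real^'n^'n" where
  "mat_inv_sqrt A = matrix_inv (mat_sqrt A)"

definition mat_pow :: "real^'n^'n \<Rightarrow> nat \<Rightarrow> real^'n^'n" where
  "mat_pow A k = (((**) A) ^^ k) (mat 1)"

text \<open>\<^const>\<open>exp\<close> is not usable here: it needs a Banach algebra whose product is \<open>**\<close>.\<close>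

definition mat_exp :: "real^'n^'n \<Rightarrow> real^'n^'n" where
  "mat_exp A = (\<Sum>k. (1 / fact k) *\<^sub>R mat_pow A k)"

text \<open>
  The principal logarithm of a positive definite matrix is its unique symmetric logarithm. Its
  value on other matrices is irrelevant, as is that of \<^const>\<open>mat_sqrt\<close>.
\<close>

definition mat_log :: "real^'n^'n \<Rightarrow> real^'n^'n" where
  "mat_log A = (THE L. symmetric_mat L \<and> mat_exp L = A)"

subsection \<open>Squared distances and divergences\<close>

definition frobenius_dist2 :: "real^'n^'n \<Rightarrow> real^'n^'n \<Rightarrow> real" where
  "frobenius_dist2 S T = (norm (S - T))\<^sup>2"

definition airm_dist2 :: "real^'n^'n \<Rightarrow> real^'n^'n \<Rightarrow> real" where
  "airm_dist2 S T = (norm (mat_log (mat_inv_sqrt S ** T ** mat_inv_sqrt S)))\<^sup>2"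

definition jbld :: "real^'n^'n \<Rightarrow> real^'n^'n \<Rightarrow> real" where
  "jbld S T = ln (det ((1/2) *\<^sub>R (S + T))) - (1/2) * ln (det (S ** T))"

subsection \<open>The map \<open>\<Pi>\<close>\<close>

definition proj_matrix :: "real^'k^'d \<Rightarrow> real^'d^'k" where
  "proj_matrix X = mat_inv_sqrt (transpose X ** X) ** transpose X"

text \<open>
  \<open>proj X A\<close> is \<open>\<Pi>(A) = P A\<close> for the \<open>P\<close> built from \<open>X\<close>; on a single vector \<open>x\<close> of \<open>\<real>\<^sup>d\<close>, \<open>\<Pi>(x)\<close> is
  \<open>proj_matrix X *v x\<close>.
\<close>

definition proj :: "real^'k^'d \<Rightarrow> real^'m^'d \<Rightarrow> real^'m^'k" where
  "proj X A = proj_matrix X ** A"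

end

(*
  The columns of Q = P^T are orthonormal and span the column space of X, so Q P fixes X, Phi and
  Phi*. Hence P is isometric on the columns of X, and Sigma_eps(Phi) is the extension of
  Sigma_eps(P Phi) along Q by the scalar eps on the orthogonal complement of the range of Q. Such
  extensions are compatible with products and, by diagonalisation, with square roots and
  logarithms. Differences and the logarithm in AIRM extend by 0, which does not change the
  Frobenius norm. Determinants pick up a power of eps, which cancels in JBLD.
*)

theory Submission
  imports Defs
begin

text \<open>Square root and logarithm are definite descriptions, so evaluating either one requires
  uniqueness as well as existence. Both become accessible once every symmetric matrix is a
  combination of rank-one projections, since a function of the matrix then changes only the
  coefficients. The extension goes from size d' up to size d: positive definiteness of X^T X makes X
  injective, hence d' \<le> d. The scalar on the complement is \<epsilon> because the covariance
  itself vanishes there, which leaves only the regularising term.\<close>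

section \<open>Matrix algebra\<close>

lemma inner_transpose_mult: "(transpose A *v x) \<bullet> y = x \<bullet> ((A :: real^'m^'n) *v y)"
  by (simp add: dot_lmul_matrix)

lemma pos_def_imp_symmetric: "pos_def A \<Longrightarrow> symmetric_mat A"
  by (simp add: pos_def_def)

lemma symmetric_mat_inner_commute:
  assumes "symmetric_mat A"
  shows "(A *v x) \<bullet> y = x \<bullet> (A *v y)"
  by (metis assms inner_transpose_mult symmetric_mat_def)

lemma outer_product_mult_vec: "outer_product u v *v x = (v \<bullet> x) *\<^sub>R u"
  by (simp add: outer_product_def matrix_vector_mult_def vec_eq_iff inner_vec_def
      sum_distrib_left sum_distrib_right mult_ac)

lemma inner_outer_product:
  "outer_product u v \<bullet> outer_product u' v' = (u \<bullet> u') * (v \<bullet> v')"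
  by (simp add: outer_product_def inner_vec_def sum_product mult_ac)

lemma sum_matrix_vector_mult: "(\<Sum>i\<in>I. f i) *v x = (\<Sum>i\<in>I. f i *v (x :: real^'n))"
  by (induction I rule: infinite_finite_induct) (auto simp: matrix_vector_mult_add_rdistrib)

lemma matrix_vector_mult_sum: "A *v (\<Sum>i\<in>I. f i) = (\<Sum>i\<in>I. A *v (f i :: real^'n))"
  by (induction I rule: infinite_finite_induct) (auto simp: matrix_vector_right_distrib)

lemma scaleR_matrix_vector_mult: "(a *\<^sub>R A) *v x = a *\<^sub>R (A *v (x :: real^'n))"
  by (rule scaleR_matrix_vector_assoc [symmetric])

lemma matrix_mult_vec_assoc: "(A ** B) *v x = A *v (B *v (x :: real^'n))"
  by (simp add: matrix_vector_mul_assoc)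

text \<open>Matrix identities are checked by applying both sides to a vector, and these rules push
  the vector inwards. The standard simp rule \<open>transpose_matrix_vector\<close> would turn
  \<open>transpose A *v x\<close> into \<open>x v* A\<close>, out of their reach, so it is often
  deleted below.\<close>

lemmas matrix_vec_simps =
  outer_product_mult_vec sum_matrix_vector_mult matrix_vector_mult_sum
  scaleR_matrix_vector_mult matrix_mult_vec_assoc
  matrix_vector_mult_add_rdistrib matrix_vector_mult_diff_rdistrib
  matrix_vector_mult_scaleR matrix_vector_mult_diff_distrib matrix_vector_right_distrib

lemma outer_product_matrix_mult:
  "outer_product (A *v u) (A *v v) = A ** outer_product u v ** transpose (A :: real^'m^'n)"
proof -
  have "v \<bullet> (transpose A *v x) = (A *v v) \<bullet> x" for x
    using inner_transpose_mult [of A x v] by (simp add: inner_commute del: transpose_matrix_vector)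
  then show ?thesis
    unfolding matrix_eq by (simp add: matrix_vec_simps del: transpose_matrix_vector)
qed

text \<open>A one-sided inverse of a square matrix is two-sided, so the choice made by
  \<open>matrix_inv\<close> has a single candidate.\<close>

lemma matrix_inv_eqI:
  fixes A B :: "real^'n^'n"
  assumes "A ** B = mat 1"
  shows "matrix_inv A = B"
proof -
  have "B ** A = mat 1"
    using assms matrix_left_right_inverse by blast
  then have "invertible A"
    using assms invertible_def by blast
  then have "A ** matrix_inv A = mat 1"
    by (simp add: invertible_def matrix_inv_def) (metis (mono_tags, lifting) someI_ex)
  then show ?thesis
    by (metis \<open>B ** A = mat 1\<close> matrix_mul_assoc matrix_mul_lid matrix_mul_rid)
qed

section \<open>Spectral decomposition\<close>

text \<open>A set instead of an orthogonal matrix: eigenvectors need no numbering, and completing a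
  partial basis is a union.\<close>

definition orthonormal_basis :: "(real^'n) set \<Rightarrow> bool" where
  "orthonormal_basis B \<longleftrightarrow> pairwise orthogonal B \<and> (\<forall>b\<in>B. norm b = 1) \<and> span B = UNIV"

text \<open>The diagonalisation U diag(c) U^T, with each eigenvalue attached to its
  eigenvector.\<close>

definition spectral :: "(real^'n) set \<Rightarrow> (real^'n \<Rightarrow> real) \<Rightarrow> real^'n^'n" where
  "spectral B c = (\<Sum>b\<in>B. c b *\<^sub>R outer_product b b)"

lemma orthonormal_basis_finite: "orthonormal_basis B \<Longrightarrow> finite B"
  by (simp add: orthonormal_basis_def pairwise_orthogonal_imp_finite)

lemma orthonormal_basis_inner:
  "orthonormal_basis B \<Longrightarrow> b \<in> B \<Longrightarrow> b' \<in> B \<Longrightarrow> b \<bullet> b' = (if b = b' then 1 else 0)"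
  by (auto simp: orthonormal_basis_def pairwise_def orthogonal_def norm_eq_1)

lemma card_orthonormal_basis:
  fixes B :: "(real^'n) set"
  assumes "orthonormal_basis B"
  shows "card B = CARD('n)"
proof -
  have "independent B"
    using assms by (intro pairwise_orthogonal_independent) (auto simp: orthonormal_basis_def)
  then show ?thesis
    using assms dim_eq_card [of B UNIV] by (simp add: orthonormal_basis_def)
qed

lemma orthonormal_basis_eqI:
  assumes "orthonormal_basis B" "\<And>b. b \<in> B \<Longrightarrow> b \<bullet> x = b \<bullet> y"
  shows "x = y"
proof -
  have "orthogonal (x - y) z" if "z \<in> span B" for z
    using that
  proof (rule orthogonal_to_span)
    show "orthogonal (x - y) b" if "b \<in> B" for b
      using assms(2) [OF that] by (simp add: orthogonal_def inner_commute inner_diff_right)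
  qed
  then have "orthogonal (x - y) (x - y)"
    using assms(1) by (simp add: orthonormal_basis_def)
  then show ?thesis by (simp add: orthogonal_self)
qed

lemma orthonormal_basis_matrix_eqI:
  assumes "orthonormal_basis B" "\<And>b. b \<in> B \<Longrightarrow> M *v b = N *v (b :: real^'n)"
  shows "M = N"
proof -
  have "M *v x = N *v x" for x
  proof (rule linear_eq_on_span [of "(*v) M" "(*v) N" B])
    show "x \<in> span B" using assms(1) by (simp add: orthonormal_basis_def)
  qed (use assms in auto)
  then show ?thesis by (simp add: matrix_eq)
qed

lemma symmetric_spectral: "symmetric_mat (spectral B c)"
  by (simp add: symmetric_mat_def spectral_def transpose_def outer_product_def vec_eq_iff mult_ac)

lemma spectral_cong: "(\<And>b. b \<in> B \<Longrightarrow> c b = c' b) \<Longrightarrow> spectral B c = spectral B c'"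
  by (simp add: spectral_def cong: sum.cong)

lemma spectral_mult_basis:
  assumes B: "orthonormal_basis B" and b: "b \<in> B"
  shows "spectral B c *v b = c b *\<^sub>R b"
proof -
  have "spectral B c *v b = (\<Sum>b'\<in>B. if b' = b then c b *\<^sub>R b else 0)"
    unfolding spectral_def
    by (auto simp: matrix_vec_simps orthonormal_basis_inner [OF B _ b] intro!: sum.cong)
  then show ?thesis
    using b by (simp add: orthonormal_basis_finite [OF B])
qed

lemma spectral_one: "orthonormal_basis B \<Longrightarrow> spectral B (\<lambda>b. 1) = mat 1"
  by (rule orthonormal_basis_matrix_eqI [of B]) (simp_all add: spectral_mult_basis)

lemma spectral_mult:
  "orthonormal_basis B \<Longrightarrow> spectral B c ** spectral B d = spectral B (\<lambda>b. c b * d b)"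
  by (rule orthonormal_basis_matrix_eqI [of B])
    (simp_all add: spectral_mult_basis matrix_vec_simps)

lemma inner_spectral:
  assumes "orthonormal_basis B"
  shows "x \<bullet> (spectral B c *v x) = (\<Sum>b\<in>B. c b * (b \<bullet> x)\<^sup>2)"
  by (simp add: spectral_def matrix_vec_simps inner_sum_right power2_eq_square inner_commute mult_ac)

lemma pos_def_spectral_iff:
  assumes B: "orthonormal_basis B"
  shows "pos_def (spectral B c) \<longleftrightarrow> (\<forall>b\<in>B. 0 < c b)"
proof
  assume pd: "pos_def (spectral B c)"
  show "\<forall>b\<in>B. 0 < c b"
  proof
    fix b assume b: "b \<in> B"
    then have 1: "b \<bullet> b = 1" using orthonormal_basis_inner [OF B] by simp
    then have "b \<noteq> 0" by auto
    then have "0 < b \<bullet> (spectral B c *v b)"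
      using pd by (simp add: pos_def_def)
    then show "0 < c b"
      by (simp add: spectral_mult_basis [OF B b] 1)
  qed
next
  assume c: "\<forall>b\<in>B. 0 < c b"
  have "0 < x \<bullet> (spectral B c *v x)" if "x \<noteq> 0" for x
  proof -
    \<comment> \<open>A nonzero vector has a nonzero coordinate; its term is positive and the others
      are nonnegative.\<close>
    obtain b where b: "b \<in> B" "b \<bullet> x \<noteq> 0"
      using orthonormal_basis_eqI [OF B, of x 0] \<open>x \<noteq> 0\<close> by auto
    show ?thesis
      unfolding inner_spectral [OF B]
      by (rule sum_pos2 [OF orthonormal_basis_finite [OF B] b(1)])
        (use b c in \<open>auto intro: mult_nonneg_nonneg less_imp_le\<close>)
  qed
  then show "pos_def (spectral B c)"
    by (simp add: pos_def_def symmetric_spectral)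
qed

text \<open>Pythagoras: the projections \<open>outer_product b b\<close> are orthonormal for the
  Frobenius inner product.\<close>

lemma norm_spectral:
  assumes B: "orthonormal_basis B"
  shows "(norm (spectral B c))\<^sup>2 = (\<Sum>b\<in>B. (c b)\<^sup>2)"
proof -
  have "(norm (spectral B c))\<^sup>2 = (\<Sum>b\<in>B. \<Sum>b'\<in>B. if b' = b then (c b)\<^sup>2 else 0)"
    unfolding power2_norm_eq_inner spectral_def inner_sum_left inner_sum_right
    by (auto intro!: sum.cong
        simp: inner_outer_product orthonormal_basis_inner [OF B] power2_eq_square)
  then show ?thesis
    by (simp add: orthonormal_basis_finite [OF B])
qed

lemma det_spectral:
  fixes B :: "(real^'n) set"
  assumes B: "orthonormal_basis B"
  shows "det (spectral B c) = prod c B"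
proof -
  have fin: "finite B" by (rule orthonormal_basis_finite [OF B])
  \<comment> \<open>To become the columns of a square matrix U, the basis has to be numbered by the
    index type; the cardinalities agree.\<close>
  obtain f :: "'n \<Rightarrow> real^'n" where f: "bij_betw f UNIV B"
    using fin finite_same_card_bij [of "UNIV :: 'n set" B] card_orthonormal_basis [OF B] by auto
  have fB: "f i \<in> B" for i using f bij_betwE by blast
  have inj: "f i = f j \<longleftrightarrow> i = j" for i j
    using f by (auto simp: bij_betw_def inj_on_def)
  define U :: "real^'n^'n" where "U = (\<chi> i j. f j $ i)"
  define D :: "real^'n^'n" where "D = (\<chi> i j. if i = j then c (f i) else 0)"
  have column_U: "column i U = f i" for i
    by (simp add: U_def column_def)
  have U: "transpose U ** U = mat 1"
    unfolding matrix_mult_transpose_dot_column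
    unfolding column_U by (simp add: vec_eq_iff [where x = "vec_lambda _"] mat_def
        orthonormal_basis_inner [OF B fB fB] inj)
  have "spectral B c = (\<Sum>j\<in>UNIV. c (f j) *\<^sub>R outer_product (f j) (f j))"
    unfolding spectral_def using sum.reindex_bij_betw [OF f] by (metis (no_types, lifting) sum.cong)
  also have "\<dots> = U ** D ** transpose U"
    by (simp add: vec_eq_iff matrix_matrix_mult_def U_def D_def transpose_def outer_product_def
        if_distrib [of "\<lambda>x. _ * x"] mult_ac cong: if_cong)
  finally have "det (spectral B c) = det D * det (transpose U ** U)"
    by (simp add: det_mul)
  also have "\<dots> = (\<Prod>i\<in>UNIV. c (f i))"
    by (simp add: U det_diagonal D_def)
  also have "\<dots> = prod c B"
    using prod.reindex_bij_betw [OF f] .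
  finally show ?thesis .
qed

section \<open>Diagonalisation of symmetric matrices\<close>

text \<open>A maximiser of the Rayleigh quotient on an invariant subspace is an eigenvector.\<close>

lemma symmetric_eigenvector:
  fixes A :: "real^'n^'n"
  assumes A: "symmetric_mat A" and V: "subspace V" and inv: "\<And>x. x \<in> V \<Longrightarrow> A *v x \<in> V"
    and ne: "V \<noteq> {0}"
  obtains v l where "v \<in> V" "norm v = 1" "A *v v = l *\<^sub>R v"
proof -
  define K where "K = V \<inter> sphere 0 1"
  have "compact K"
    unfolding K_def using closed_subspace [OF V] by (simp add: closed_Int_compact)
  obtain w where w: "w \<in> V" "w \<noteq> 0"
    using ne V subspace_0 by blast
  have "w /\<^sub>R norm w \<in> K"
    using w V by (simp add: K_def subspace_scale)
  then have "K \<noteq> {}" by blast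
  have "continuous_on K (\<lambda>x. x \<bullet> (A *v x))"
    by (intro continuous_intros linear_continuous_on matrix_vector_mul_bounded_linear)
  then obtain v where v: "v \<in> K" and max: "\<And>y. y \<in> K \<Longrightarrow> y \<bullet> (A *v y) \<le> v \<bullet> (A *v v)"
    using continuous_attains_sup [OF \<open>compact K\<close> \<open>K \<noteq> {}\<close>] by blast
  define l where "l = v \<bullet> (A *v v)"
  have vV: "v \<in> V" and nv: "norm v = 1"
    using v by (auto simp: K_def)
  \<comment> \<open>This form is nonnegative on V and vanishes at v, so its first-order term at v
    must vanish in every direction of V. The direction used is the residual z, for which that term
    is 2 t (z \<bullet> z).\<close>
  define q where "q y = l * (y \<bullet> y) - y \<bullet> (A *v y)" for y
  have q_nonneg: "0 \<le> q y" if "y \<in> V" for y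
  proof (cases "y = 0")
    case False
    have "y /\<^sub>R norm y \<in> K"
      using that False V by (simp add: K_def subspace_scale)
    then have "(y /\<^sub>R norm y) \<bullet> (A *v (y /\<^sub>R norm y)) \<le> l"
      unfolding l_def by (rule max)
    then have "(y \<bullet> (A *v y)) / (norm y)\<^sup>2 \<le> l"
      by (simp add: matrix_vec_simps power2_eq_square divide_simps)
    then show ?thesis
      using False by (simp add: q_def divide_simps flip: power2_norm_eq_inner split: if_splits)
  qed (simp add: q_def)
  define z where "z = l *\<^sub>R v - A *v v"
  have zV: "z \<in> V"
    unfolding z_def using V vV inv by (simp add: subspace_diff subspace_scale)
  have expand: "q (v + t *\<^sub>R z) = 2 * t * (z \<bullet> z) + t\<^sup>2 * q z" for t
  proof -
    have vAz: "v \<bullet> (A *v z) = z \<bullet> (A *v v)"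
      using symmetric_mat_inner_commute [OF A, of v z] by (simp add: inner_commute)
    have zAv: "z \<bullet> (A *v v) = l * (v \<bullet> z) - z \<bullet> z"
      using arg_cong [OF z_def, of "(\<bullet>) z"] by (simp add: inner_diff_right inner_commute [of z v])
    have "v \<bullet> v = 1" using nv by (simp add: norm_eq_1)
    then show ?thesis
      by (simp add: q_def matrix_vec_simps inner_add_left inner_add_right l_def [symmetric]
          vAz zAv inner_commute [of z v] algebra_simps power2_eq_square)
  qed
  have "z \<bullet> z = 0"
  proof (rule ccontr)
    assume "z \<bullet> z \<noteq> 0"
    then have zz: "0 < z \<bullet> z" by simp
    \<comment> \<open>A negative step small enough for the linear term to dominate; the added 1
      keeps the denominator positive when \<open>q z\<close> is 0.\<close>
    define t where "t = - (z \<bullet> z) / (q z + 1)"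
    have qz: "0 \<le> q z" by (rule q_nonneg [OF zV])
    have t: "t < 0" using zz qz by (simp add: t_def divide_simps)
    have "v + t *\<^sub>R z \<in> V" using V vV zV by (simp add: subspace_add subspace_scale)
    then have "0 \<le> t * (2 * (z \<bullet> z) + t * q z)"
      using q_nonneg [of "v + t *\<^sub>R z"] expand [of t] by (simp add: algebra_simps power2_eq_square)
    then have "2 * (z \<bullet> z) + t * q z \<le> 0"
      using t by (simp add: zero_le_mult_iff)
    moreover have "t * (q z + 1) = - (z \<bullet> z)" using qz by (simp add: t_def)
    ultimately show False using t zz by (simp add: algebra_simps)
  qed
  then have "A *v v = l *\<^sub>R v" by (simp add: z_def)
  with that vV nv show thesis by blast
qed

text \<open>Induction on the dimension of an invariant subspace. After splitting off an eigenvector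
  v, its complement W in V is again invariant: by symmetry, v \<bullet> A x = A v \<bullet> x = l (v
  \<bullet> x) = 0 for x in W.\<close>

lemma symmetric_eigenbasis_subspace:
  fixes A :: "real^'n^'n"
  assumes A: "symmetric_mat A"
  shows "subspace V \<Longrightarrow> (\<And>x. x \<in> V \<Longrightarrow> A *v x \<in> V) \<Longrightarrow>
    \<exists>B. pairwise orthogonal B \<and> (\<forall>b\<in>B. norm b = 1) \<and> span B = V \<and> (\<forall>b\<in>B. \<exists>l. A *v b = l *\<^sub>R b)"
proof (induction "dim V" arbitrary: V rule: less_induct)
  case less
  note V = less.prems(1) and inv = less.prems(2)
  show ?case
  proof (cases "V = {0}")
    case True
    then show ?thesis by (intro exI [of _ "{}"]) auto
  next
    case False
    obtain v l where v: "v \<in> V" "norm v = 1" "A *v v = l *\<^sub>R v"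
      using symmetric_eigenvector [OF A V inv False] by metis
    have vv: "v \<bullet> v = 1" using v by (simp add: norm_eq_1)
    define W where "W = V \<inter> {x. v \<bullet> x = 0}"
    have W: "subspace W"
      unfolding W_def using V by (simp add: subspace_inter subspace_hyperplane)
    have "v \<notin> W" by (simp add: W_def vv)
    then have "W \<subset> V" using v unfolding W_def by blast
    then have "dim W < dim V"
      using V W by (intro dim_psubset) (simp add: span_eq_iff [THEN iffD2])
    moreover have "A *v x \<in> W" if "x \<in> W" for x
      using that inv symmetric_mat_inner_commute [OF A, of v x] by (simp add: W_def v)
    ultimately obtain B where B: "pairwise orthogonal B" "\<forall>b\<in>B. norm b = 1" "span B = W"
        "\<forall>b\<in>B. \<exists>l. A *v b = l *\<^sub>R b"
      using less.hyps W by metis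
    have BW: "B \<subseteq> W" using B(3) span_superset by blast
    have "span (insert v B) = V"
    proof
      show "span (insert v B) \<subseteq> V"
        using v BW V by (intro span_minimal) (auto simp: W_def)
      show "V \<subseteq> span (insert v B)"
      proof
        fix x assume "x \<in> V"
        then have "x - (v \<bullet> x) *\<^sub>R v \<in> W"
          using V v by (simp add: W_def subspace_diff subspace_scale inner_diff_right vv)
        then show "x \<in> span (insert v B)"
          using B(3) span_breakdown_eq by blast
      qed
    qed
    moreover have "pairwise orthogonal (insert v B)"
      using B(1) BW by (auto simp: pairwise_insert W_def orthogonal_def inner_commute)
    ultimately show ?thesis
      using B v by (intro exI [of _ "insert v B"]) auto
  qed
qed

theorem symmetric_imp_spectral:
  fixes A :: "real^'n^'n"
  assumes "symmetric_mat A"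
  obtains B c where "orthonormal_basis B" "A = spectral B c"
proof -
  obtain B where B: "orthonormal_basis B" "\<forall>b\<in>B. \<exists>l. A *v b = l *\<^sub>R b"
    using symmetric_eigenbasis_subspace [OF assms, of UNIV] by (auto simp: orthonormal_basis_def)
  then obtain c where "\<forall>b\<in>B. A *v b = c b *\<^sub>R b" by metis
  then have "A = spectral B c"
    using orthonormal_basis_matrix_eqI [OF B(1)] spectral_mult_basis [OF B(1)] by metis
  with B(1) that show thesis by blast
qed

text \<open>Pairing the equation with d and b shows that f (c b) = f (e d), hence c b = e d,
  whenever d \<bullet> b is nonzero; if it is zero there is nothing to compare. This gives
  uniqueness of roots and logarithms without matching eigenspaces.\<close>

lemma spectral_eq_inj_on:
  assumes B: "orthonormal_basis B" and D: "orthonormal_basis D"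
    and eq: "spectral B (\<lambda>b. f (c b)) = spectral D (\<lambda>b. f (e b))"
    and inj: "inj_on f (c ` B \<union> e ` D)"
  shows "spectral B c = spectral D e"
proof (rule orthonormal_basis_matrix_eqI [OF B])
  fix b assume b: "b \<in> B"
  show "spectral B c *v b = spectral D e *v b"
  proof (rule orthonormal_basis_eqI [OF D])
    fix d assume d: "d \<in> D"
    have inner_D: "d \<bullet> (spectral D h *v b) = h d * (d \<bullet> b)" for h
      using symmetric_mat_inner_commute [OF symmetric_spectral, of D h d b]
      by (simp add: spectral_mult_basis [OF D d])
    have "f (c b) * (d \<bullet> b) = f (e d) * (d \<bullet> b)"
      using arg_cong [OF eq, of "\<lambda>M. d \<bullet> (M *v b)"]
      by (simp add: spectral_mult_basis [OF B b] inner_D)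
    then have "d \<bullet> b = 0 \<or> f (c b) = f (e d)"
      by simp
    then have "d \<bullet> b = 0 \<or> c b = e d"
      using inj_onD [OF inj, of "c b" "e d"] b d by blast
    then show "d \<bullet> (spectral B c *v b) = d \<bullet> (spectral D e *v b)"
      by (auto simp: spectral_mult_basis [OF B b] inner_D)
  qed
qed

section \<open>Square root, exponential and logarithm\<close>

text \<open>Any competing positive definite root is diagonalised in its own basis. Its eigenvalues
  are positive, where squaring is injective, so it agrees with the evident root.\<close>

lemma mat_sqrt_spectral:
  assumes B: "orthonormal_basis B" and c: "\<And>b. b \<in> B \<Longrightarrow> 0 < c b"
  shows "mat_sqrt (spectral B c) = spectral B (\<lambda>b. sqrt (c b))"
  unfolding mat_sqrt_def
proof (rule the_equality)
  have "spectral B (\<lambda>b. sqrt (c b)) ** spectral B (\<lambda>b. sqrt (c b)) = spectral B c"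
    unfolding spectral_mult [OF B] by (rule spectral_cong) (simp add: less_imp_le [OF c])
  then show 1: "pos_def (spectral B (\<lambda>b. sqrt (c b))) \<and>
      spectral B (\<lambda>b. sqrt (c b)) ** spectral B (\<lambda>b. sqrt (c b)) = spectral B c"
    using c by (simp add: pos_def_spectral_iff [OF B])
  fix R assume R: "pos_def R \<and> R ** R = spectral B c"
  then obtain D e where D: "orthonormal_basis D" and Re: "R = spectral D e"
    using symmetric_imp_spectral pos_def_def by metis
  have e: "\<forall>b\<in>D. 0 < e b"
    using R pos_def_spectral_iff [OF D] Re by blast
  show "R = spectral B (\<lambda>b. sqrt (c b))"
    unfolding Re
  proof (rule spectral_eq_inj_on [OF D B, where f = "\<lambda>x. x * x"])
    show "spectral D (\<lambda>b. e b * e b) = spectral B (\<lambda>b. sqrt (c b) * sqrt (c b))"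
      using R 1 by (simp add: Re spectral_mult B D)
    show "inj_on (\<lambda>x. x * x) (e ` D \<union> (\<lambda>b. sqrt (c b)) ` B)"
    proof (rule inj_onI)
      fix x y assume "x \<in> e ` D \<union> (\<lambda>b. sqrt (c b)) ` B" "y \<in> e ` D \<union> (\<lambda>b. sqrt (c b)) ` B"
      then have "0 < x" "0 < y" using e c by auto
      moreover assume "x * x = y * y"
      ultimately show "x = y" by (simp add: square_eq_iff)
    qed
  qed
qed

lemma mat_pow_spectral:
  assumes B: "orthonormal_basis B"
  shows "mat_pow (spectral B c) k = spectral B (\<lambda>b. c b ^ k)"
  by (induction k) (simp_all add: mat_pow_def spectral_one [OF B] spectral_mult [OF B])

lemma mat_exp_spectral:
  assumes B: "orthonormal_basis B"
  shows "mat_exp (spectral B c) = spectral B (\<lambda>b. exp (c b))"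
proof -
  \<comment> \<open>The matrix series splits into one scalar exponential series per basis vector, so
    convergence is a scalar matter.\<close>
  have "(\<lambda>k. \<Sum>b\<in>B. (c b ^ k /\<^sub>R fact k) *\<^sub>R outer_product b b) sums
      (\<Sum>b\<in>B. exp (c b) *\<^sub>R outer_product b b)"
    by (intro sums_sum bounded_linear.sums [OF bounded_linear_scaleR_left] exp_converges)
  then have "(\<lambda>k. (1 / fact k) *\<^sub>R mat_pow (spectral B c) k) sums spectral B (\<lambda>b. exp (c b))"
    unfolding mat_pow_spectral [OF B] by (simp add: spectral_def scaleR_sum_right divide_inverse mult_ac)
  then show ?thesis
    by (simp add: mat_exp_def sums_iff)
qed

text \<open>Uniqueness uses that the real exponential is injective everywhere, so symmetry alone
  singles out the logarithm.\<close>

lemma mat_log_spectral: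
  assumes B: "orthonormal_basis B" and c: "\<And>b. b \<in> B \<Longrightarrow> 0 < c b"
  shows "mat_log (spectral B c) = spectral B (\<lambda>b. ln (c b))"
  unfolding mat_log_def
proof (rule the_equality)
  show 1: "symmetric_mat (spectral B (\<lambda>b. ln (c b))) \<and>
      mat_exp (spectral B (\<lambda>b. ln (c b))) = spectral B c"
    using spectral_cong [of B "\<lambda>b. exp (ln (c b))" c] c
    by (simp add: symmetric_spectral mat_exp_spectral [OF B])
  fix L assume L: "symmetric_mat L \<and> mat_exp L = spectral B c"
  then obtain D e where D: "orthonormal_basis D" and Le: "L = spectral D e"
    using symmetric_imp_spectral by metis
  show "L = spectral B (\<lambda>b. ln (c b))"
    unfolding Le
  proof (rule spectral_eq_inj_on [OF D B, where f = exp])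
    show "spectral D (\<lambda>b. exp (e b)) = spectral B (\<lambda>b. exp (ln (c b)))"
      using L 1 by (simp add: Le mat_exp_spectral B D)
  qed (simp add: inj_on_def)
qed

lemma pos_def_mat_sqrt:
  assumes "pos_def A"
  shows "pos_def (mat_sqrt A)" "mat_sqrt A ** mat_sqrt A = A"
proof -
  obtain B c where B: "orthonormal_basis B" and A: "A = spectral B c"
    using assms symmetric_imp_spectral pos_def_def by metis
  have c: "\<And>b. b \<in> B \<Longrightarrow> 0 < c b"
    using assms pos_def_spectral_iff [OF B] A by blast
  show "pos_def (mat_sqrt A)"
    by (simp add: A mat_sqrt_spectral [OF B c] pos_def_spectral_iff [OF B] c)
  show "mat_sqrt A ** mat_sqrt A = A"
    by (simp add: A mat_sqrt_spectral [OF B c] spectral_mult [OF B])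
      (rule spectral_cong, simp add: c less_imp_le)
qed

lemma pos_def_mat_inv_sqrt:
  assumes "pos_def A"
  shows "symmetric_mat (mat_inv_sqrt A)" "mat_sqrt A ** mat_inv_sqrt A = mat 1"
proof -
  obtain B c where B: "orthonormal_basis B" and A: "A = spectral B c"
    using assms symmetric_imp_spectral pos_def_def by metis
  have c: "\<And>b. b \<in> B \<Longrightarrow> 0 < c b"
    using assms pos_def_spectral_iff [OF B] A by blast
  have "spectral B (\<lambda>b. sqrt (c b)) ** spectral B (\<lambda>b. 1 / sqrt (c b)) = spectral B (\<lambda>b. 1)"
    unfolding spectral_mult [OF B] by (rule spectral_cong) (use c in fastforce)
  then have 1: "mat_sqrt A ** spectral B (\<lambda>b. 1 / sqrt (c b)) = mat 1"
    by (simp add: A mat_sqrt_spectral [OF B c] spectral_one [OF B])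
  then have "mat_inv_sqrt A = spectral B (\<lambda>b. 1 / sqrt (c b))"
    unfolding mat_inv_sqrt_def by (rule matrix_inv_eqI)
  with 1 show "symmetric_mat (mat_inv_sqrt A)" "mat_sqrt A ** mat_inv_sqrt A = mat 1"
    by (simp_all add: symmetric_spectral)
qed

text \<open>The quadratic form at x is that of T at R x, and the left inverse keeps R x nonzero. It
  makes the argument of the logarithm in AIRM positive definite.\<close>

lemma pos_def_congruence:
  fixes T R R' :: "real^'n^'n"
  assumes T: "pos_def T" and R: "symmetric_mat R" and inv: "R' ** R = mat 1"
  shows "pos_def (R ** T ** R)"
proof -
  have "0 < x \<bullet> ((R ** T ** R) *v x)" if "x \<noteq> 0" for x
  proof -
    have "R' *v (R *v x) = x"
      by (simp add: inv flip: matrix_mult_vec_assoc)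
    then have "R *v x \<noteq> 0"
      using that by auto
    then have "0 < (R *v x) \<bullet> (T *v (R *v x))"
      using T by (simp add: pos_def_def)
    then show ?thesis
      by (simp add: matrix_mult_vec_assoc symmetric_mat_inner_commute [OF R])
  qed
  moreover have "symmetric_mat (R ** T ** R)"
    using T R by (simp add: symmetric_mat_def pos_def_def matrix_transpose_mul matrix_mul_assoc)
  ultimately show ?thesis by (simp add: pos_def_def)
qed

section \<open>Extending a matrix along an isometry\<close>

text \<open>
  For \<open>Q\<close> with orthonormal columns, this is the operator acting as \<open>A\<close> on the range of \<open>Q\<close> (identified
  with the domain of \<open>Q\<close>) and as the scalar \<open>a\<close> on its orthogonal complement.
\<close>

definition isometric_lift :: "real^'k^'d \<Rightarrow> real \<Rightarrow> real^'k^'k \<Rightarrow> real^'d^'d" where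
  "isometric_lift Q a A = Q ** A ** transpose Q + a *\<^sub>R (mat 1 - Q ** transpose Q)"

lemma isometric_lift_mult_range:
  assumes "transpose Q ** Q = mat 1"
  shows "isometric_lift Q a A *v (Q *v x) = Q *v (A *v x)"
proof -
  have "transpose Q *v (Q *v x) = x"
    by (simp add: assms flip: matrix_mult_vec_assoc)
  then show ?thesis
    by (simp add: isometric_lift_def matrix_vec_simps del: transpose_matrix_vector)
qed

lemma isometric_lift_mult_complement:
  "transpose Q *v x = 0 \<Longrightarrow> isometric_lift Q a A *v x = a *\<^sub>R x"
  by (simp add: isometric_lift_def matrix_vec_simps del: transpose_matrix_vector)

text \<open>Every y is the sum of Q (Q^T y) and a vector killed by Q^T, so an operator is determined
  by its action on these two kinds of vectors.\<close>

lemma isometric_lift_eqI: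
  fixes Q :: "real^'k^'d" and M :: "real^'d^'d"
  assumes Q: "transpose Q ** Q = mat 1"
    and range: "\<And>x. M *v (Q *v x) = Q *v (A *v x)"
    and complement: "\<And>x. transpose Q *v x = 0 \<Longrightarrow> M *v x = a *\<^sub>R x"
  shows "M = isometric_lift Q a A"
proof -
  have "M *v y = isometric_lift Q a A *v y" for y
  proof -
    define x where "x = transpose Q *v y"
    have "transpose Q *v (Q *v x) = x" for x :: "real^'k"
      by (simp add: Q flip: matrix_mult_vec_assoc)
    then have z: "transpose Q *v (y - Q *v x) = 0"
      by (simp add: x_def matrix_vector_mult_diff_distrib del: transpose_matrix_vector)
    have y: "y = Q *v x + (y - Q *v x)" by simp
    show ?thesis
      \<comment> \<open>The decomposition of y mentions y again and would loop as a rewrite rule, so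
        it is applied exactly once on each side.\<close>
      by (subst (1 2) y) (simp only: matrix_vector_right_distrib range complement [OF z]
          isometric_lift_mult_range [OF Q] isometric_lift_mult_complement [OF z])
  qed
  then show ?thesis by (simp add: matrix_eq)
qed

lemma isometric_lift_mult:
  assumes Q: "transpose Q ** Q = mat 1"
  shows "isometric_lift Q a A ** isometric_lift Q b B = isometric_lift Q (a * b) (A ** B)"
  by (rule isometric_lift_eqI [OF Q])
    (simp_all add: matrix_mult_vec_assoc isometric_lift_mult_range [OF Q] isometric_lift_mult_complement
      matrix_vector_mult_scaleR del: transpose_matrix_vector)

lemma isometric_lift_add:
  assumes Q: "transpose Q ** Q = mat 1"
  shows "isometric_lift Q a A + isometric_lift Q b B = isometric_lift Q (a + b) (A + B)"
  by (rule isometric_lift_eqI [OF Q])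
    (simp_all add: matrix_vec_simps isometric_lift_mult_range [OF Q] isometric_lift_mult_complement
      scaleR_add_left del: transpose_matrix_vector)

lemma isometric_lift_scaleR:
  assumes Q: "transpose Q ** Q = mat 1"
  shows "r *\<^sub>R isometric_lift Q a A = isometric_lift Q (r * a) (r *\<^sub>R A)"
  by (rule isometric_lift_eqI [OF Q])
    (simp_all add: matrix_vec_simps isometric_lift_mult_range [OF Q] isometric_lift_mult_complement
      del: transpose_matrix_vector)

lemma isometric_lift_one:
  assumes Q: "transpose Q ** Q = mat 1"
  shows "isometric_lift Q 1 (mat 1) = mat 1"
  by (rule isometric_lift_eqI [OF Q, symmetric]) simp_all

text \<open>The images Q b stay orthonormal and keep their eigenvalues; an orthonormal basis D of
  their complement carries the eigenvalue a. Since D is fixed before a and c, one basis diagonalises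
  all these lifts together. The coefficient of an image is found by Q^T (Q b) = b.\<close>

lemma isometric_lift_spectral:
  fixes Q :: "real^'k^'d" and B :: "(real^'k) set"
  assumes Q: "transpose Q ** Q = mat 1" and B: "orthonormal_basis B"
  obtains D where "orthonormal_basis ((*v) Q ` B \<union> D)" "(*v) Q ` B \<inter> D = {}" "inj_on ((*v) Q) B"
    "\<And>a c. isometric_lift Q a (spectral B c) =
       spectral ((*v) Q ` B \<union> D) (\<lambda>x. if x \<in> (*v) Q ` B then c (transpose Q *v x) else a)"
proof -
  define E where "E = (*v) Q ` B"
  have QQ: "transpose Q *v (Q *v x) = x" for x
    by (simp add: Q flip: matrix_mult_vec_assoc)
  then have inj: "inj_on ((*v) Q) B"
    by (metis inj_onI)
  have inner_Q: "(Q *v x) \<bullet> (Q *v y) = x \<bullet> y" for x y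
    by (metis QQ inner_transpose_mult inner_commute)
  have E_inner: "e \<bullet> e' = (if e = e' then 1 else 0)" if "e \<in> E" "e' \<in> E" for e e'
    using that inj orthonormal_basis_inner [OF B] by (auto simp: E_def inner_Q)
  have finE: "finite E" by (simp add: E_def orthonormal_basis_finite [OF B])
  define W where "W = {x. \<forall>e\<in>E. e \<bullet> x = 0}"
  have "subspace W"
    by (auto simp: W_def subspace_def inner_add_right)
  then obtain D where D: "D \<subseteq> W" "pairwise orthogonal D" "\<And>x. x \<in> D \<Longrightarrow> norm x = 1" "span D = W"
    using orthonormal_basis_subspace by metis
  have disj: "E \<inter> D = {}"
    using E_inner D(1) by (force simp: W_def)
  have "x \<in> span (E \<union> D)" for x
  proof -
    \<comment> \<open>The orthogonal projection of x onto the span of E; the remainder lies in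
      W.\<close>
    let ?p = "\<Sum>e\<in>E. (e \<bullet> x) *\<^sub>R e"
    have "e \<bullet> ?p = e \<bullet> x" if "e \<in> E" for e
    proof -
      have "e \<bullet> ?p = (\<Sum>e'\<in>E. if e' = e then e \<bullet> x else 0)"
        unfolding inner_sum_right using E_inner that by (auto intro!: sum.cong)
      then show ?thesis using that finE by simp
    qed
    then have "x - ?p \<in> span D"
      by (simp add: D(4) W_def inner_diff_right)
    moreover have "?p \<in> span E"
      by (intro span_sum span_scale span_base)
    ultimately have "(x - ?p) + ?p \<in> span (E \<union> D)"
      using span_mono [of D "E \<union> D"] span_mono [of E "E \<union> D"] by (intro span_add) auto
    then show ?thesis by simp
  qed
  moreover have "pairwise orthogonal (E \<union> D)"
  proof (rule pairwiseI)
    fix x y assume "x \<in> E \<union> D" "y \<in> E \<union> D" "x \<noteq> y"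
    then show "orthogonal x y"
      using E_inner D(1) D(2) by (auto simp: W_def orthogonal_def pairwise_def inner_commute)
  qed
  moreover have "norm x = 1" if "x \<in> E \<union> D" for x
    using that E_inner D(3) by (auto simp: norm_eq_1)
  ultimately have onb: "orthonormal_basis (E \<union> D)"
    by (auto simp: orthonormal_basis_def)
  have D_perp: "transpose Q *v x = 0" if "x \<in> D" for x
  proof (rule orthonormal_basis_eqI [OF B])
    fix b assume "b \<in> B"
    then have "(Q *v b) \<bullet> x = 0" using that D(1) by (auto simp: W_def E_def)
    then show "b \<bullet> (transpose Q *v x) = b \<bullet> 0"
      by (metis inner_commute inner_transpose_mult inner_zero_right)
  qed
  have "isometric_lift Q a (spectral B c) =
       spectral (E \<union> D) (\<lambda>x. if x \<in> E then c (transpose Q *v x) else a)" for a c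
  proof (rule orthonormal_basis_matrix_eqI [OF onb])
    fix x assume x: "x \<in> E \<union> D"
    show "isometric_lift Q a (spectral B c) *v x =
      spectral (E \<union> D) (\<lambda>x. if x \<in> E then c (transpose Q *v x) else a) *v x"
    proof (cases "x \<in> E")
      case True
      then obtain b where b: "b \<in> B" "x = Q *v b" by (auto simp: E_def)
      show ?thesis
        unfolding spectral_mult_basis [OF onb x]
        using True by (simp add: b(2) isometric_lift_mult_range [OF Q] spectral_mult_basis [OF B b(1)] QQ
            matrix_vector_mult_scaleR del: transpose_matrix_vector)
    next
      case False
      then have "x \<in> D" using x by simp
      then show ?thesis
        unfolding spectral_mult_basis [OF onb x]
        using False by (simp add: isometric_lift_mult_complement [OF D_perp])
    qed
  qed
  then show thesis
    using that [of D] onb disj inj unfolding E_def by blast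
qed

text \<open>The squared Frobenius norm is the sum of squared eigenvalues, and the lift only adds
  zeros.\<close>

lemma norm_isometric_lift_zero:
  assumes Q: "transpose Q ** Q = mat 1" and A: "symmetric_mat A"
  shows "norm (isometric_lift Q 0 A) = norm A"
proof -
  obtain B c where B: "orthonormal_basis B" and Ac: "A = spectral B c"
    using A symmetric_imp_spectral by metis
  obtain D where D: "orthonormal_basis ((*v) Q ` B \<union> D)" "(*v) Q ` B \<inter> D = {}" "inj_on ((*v) Q) B"
    and lift: "\<And>a c. isometric_lift Q a (spectral B c) =
       spectral ((*v) Q ` B \<union> D) (\<lambda>x. if x \<in> (*v) Q ` B then c (transpose Q *v x) else a)"
    by (rule isometric_lift_spectral [OF Q B]) (rule that)
  have QQ: "transpose Q *v (Q *v x) = x" for x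
    by (simp add: Q flip: matrix_mult_vec_assoc)
  have fin: "finite ((*v) Q ` B)" "finite D"
    using orthonormal_basis_finite [OF D(1)] by simp_all
  have notin: "x \<notin> (*v) Q ` B" if "x \<in> D" for x
    using that D(2) by blast
  have "(norm (isometric_lift Q 0 A))\<^sup>2 =
      (\<Sum>x\<in>(*v) Q ` B. (c (transpose Q *v x))\<^sup>2)"
    unfolding Ac lift norm_spectral [OF D(1)] sum.union_disjoint [OF fin D(2)]
    using notin by simp
  also have "\<dots> = (norm A)\<^sup>2"
    by (simp add: sum.reindex [OF D(3)] QQ Ac norm_spectral [OF B] del: transpose_matrix_vector)
  finally show ?thesis by simp
qed

lemma det_isometric_lift:
  fixes Q :: "real^'k^'d"
  assumes Q: "transpose Q ** Q = mat 1" and A: "symmetric_mat A"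
  shows "det (isometric_lift Q a A) = a ^ (CARD('d) - CARD('k)) * det A"
proof -
  obtain B c where B: "orthonormal_basis B" and Ac: "A = spectral B c"
    using A symmetric_imp_spectral by metis
  obtain D where D: "orthonormal_basis ((*v) Q ` B \<union> D)" "(*v) Q ` B \<inter> D = {}" "inj_on ((*v) Q) B"
    and lift: "\<And>a c. isometric_lift Q a (spectral B c) =
       spectral ((*v) Q ` B \<union> D) (\<lambda>x. if x \<in> (*v) Q ` B then c (transpose Q *v x) else a)"
    by (rule isometric_lift_spectral [OF Q B]) (rule that)
  have QQ: "transpose Q *v (Q *v x) = x" for x
    by (simp add: Q flip: matrix_mult_vec_assoc)
  have fin: "finite ((*v) Q ` B)" "finite D"
    using orthonormal_basis_finite [OF D(1)] by simp_all
  \<comment> \<open>The dimension of the complement is \<open>card D\<close>, so the natural-number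
    subtraction in the exponent is exact.\<close>
  have "CARD('d) = CARD('k) + card D"
    using card_orthonormal_basis [OF D(1)] card_Un_disjoint [OF fin D(2)]
      card_image [OF D(3)] card_orthonormal_basis [OF B] by simp
  moreover have "(\<Prod>x\<in>D. if x \<in> (*v) Q ` B then c (transpose Q *v x) else a) = (\<Prod>x\<in>D. a)"
    using D(2) by (intro prod.cong) auto
  ultimately show ?thesis
    unfolding Ac lift det_spectral [OF D(1)] prod.union_disjoint [OF fin D(2)]
    by (simp add: prod.reindex [OF D(3)] QQ det_spectral [OF B] del: transpose_matrix_vector)
qed

text \<open>The same pair of eigenbases serves every f, which acts on the scalar a as on the
  eigenvalues. Taking f to be the identity describes the lift itself; \<open>sqrt\<close> and
  \<open>ln\<close> then describe its root and logarithm.\<close>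

lemma isometric_lift_pos_def_spectral:
  assumes Q: "transpose Q ** Q = mat 1" and A: "pos_def A" and a: "0 < a"
  obtains B c E e where "orthonormal_basis B" "A = spectral B c" "\<And>b. b \<in> B \<Longrightarrow> 0 < c b"
    "orthonormal_basis E" "\<And>x. x \<in> E \<Longrightarrow> 0 < e x"
    "\<And>f. isometric_lift Q (f a) (spectral B (\<lambda>b. f (c b))) = spectral E (\<lambda>x. f (e x))"
proof -
  obtain B c where B: "orthonormal_basis B" and Ac: "A = spectral B c"
    using A symmetric_imp_spectral pos_def_def by metis
  have c: "\<And>b. b \<in> B \<Longrightarrow> 0 < c b"
    using A pos_def_spectral_iff [OF B] Ac by blast
  obtain D where D: "orthonormal_basis ((*v) Q ` B \<union> D)" "(*v) Q ` B \<inter> D = {}" "inj_on ((*v) Q) B"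
    and lift: "\<And>a c. isometric_lift Q a (spectral B c) =
       spectral ((*v) Q ` B \<union> D) (\<lambda>x. if x \<in> (*v) Q ` B then c (transpose Q *v x) else a)"
    by (rule isometric_lift_spectral [OF Q B]) (rule that)
  have QQ: "transpose Q *v (Q *v x) = x" for x
    by (simp add: Q flip: matrix_mult_vec_assoc)
  define e where "e x = (if x \<in> (*v) Q ` B then c (transpose Q *v x) else a)" for x
  have "isometric_lift Q (f a) (spectral B (\<lambda>b. f (c b))) = spectral ((*v) Q ` B \<union> D) (\<lambda>x. f (e x))" for f
    unfolding lift by (rule spectral_cong) (simp add: e_def)
  moreover have "0 < e x" for x
    using c a by (auto simp: e_def QQ simp del: transpose_matrix_vector)
  ultimately show thesis
    using that [OF B Ac c D(1), of e] by blast
qed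

lemma mat_sqrt_isometric_lift:
  assumes Q: "transpose Q ** Q = mat 1" and A: "pos_def A" and a: "0 < a"
  shows "mat_sqrt (isometric_lift Q a A) = isometric_lift Q (sqrt a) (mat_sqrt A)"
proof (rule isometric_lift_pos_def_spectral [OF assms])
  fix B c E e
  assume B: "orthonormal_basis B" and Ac: "A = spectral B c" and c: "\<And>b. b \<in> B \<Longrightarrow> 0 < c b"
    and E: "orthonormal_basis E" and e: "\<And>x. x \<in> E \<Longrightarrow> 0 < e x"
    and lift: "\<And>f. isometric_lift Q (f a) (spectral B (\<lambda>b. f (c b))) = spectral E (\<lambda>x. f (e x))"
  have "mat_sqrt (isometric_lift Q a A) = spectral E (\<lambda>x. sqrt (e x))"
    unfolding Ac using lift [of "\<lambda>x. x"] mat_sqrt_spectral [OF E e] by simp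
  then show ?thesis
    by (simp add: Ac mat_sqrt_spectral [OF B c] lift)
qed

lemma mat_inv_sqrt_isometric_lift:
  assumes Q: "transpose Q ** Q = mat 1" and A: "pos_def A" and a: "0 < a"
  shows "mat_inv_sqrt (isometric_lift Q a A) = isometric_lift Q (1 / sqrt a) (mat_inv_sqrt A)"
proof -
  have "isometric_lift Q (sqrt a) (mat_sqrt A) ** isometric_lift Q (1 / sqrt a) (mat_inv_sqrt A) = mat 1"
    using a by (simp add: isometric_lift_mult [OF Q] pos_def_mat_inv_sqrt(2) [OF A] isometric_lift_one [OF Q])
  then show ?thesis
    unfolding mat_inv_sqrt_def [of "isometric_lift Q a A"] mat_sqrt_isometric_lift [OF assms]
    by (rule matrix_inv_eqI)
qed

lemma mat_log_isometric_lift: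
  assumes Q: "transpose Q ** Q = mat 1" and A: "pos_def A" and a: "0 < a"
  shows "mat_log (isometric_lift Q a A) = isometric_lift Q (ln a) (mat_log A)"
proof (rule isometric_lift_pos_def_spectral [OF assms])
  fix B c E e
  assume B: "orthonormal_basis B" and Ac: "A = spectral B c" and c: "\<And>b. b \<in> B \<Longrightarrow> 0 < c b"
    and E: "orthonormal_basis E" and e: "\<And>x. x \<in> E \<Longrightarrow> 0 < e x"
    and lift: "\<And>f. isometric_lift Q (f a) (spectral B (\<lambda>b. f (c b))) = spectral E (\<lambda>x. f (e x))"
  have "mat_log (isometric_lift Q a A) = spectral E (\<lambda>x. ln (e x))"
    unfolding Ac using lift [of "\<lambda>x. x"] mat_log_spectral [OF E e] by simp
  then show ?thesis
    by (simp add: Ac mat_log_spectral [OF B c] lift)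
qed

lemma symmetric_mat_log:
  assumes "pos_def A"
  shows "symmetric_mat (mat_log A)"
proof -
  obtain B c where B: "orthonormal_basis B" and A: "A = spectral B c"
    using assms symmetric_imp_spectral pos_def_def by metis
  have c: "\<And>b. b \<in> B \<Longrightarrow> 0 < c b"
    using assms pos_def_spectral_iff [OF B] A by blast
  show ?thesis
    by (simp add: A mat_log_spectral [OF B c] symmetric_spectral)
qed

lemma pos_def_det_pos:
  assumes "pos_def A"
  shows "0 < det A"
proof -
  obtain B c where B: "orthonormal_basis B" and A: "A = spectral B c"
    using assms symmetric_imp_spectral pos_def_def by metis
  have c: "\<And>b. b \<in> B \<Longrightarrow> 0 < c b"
    using assms pos_def_spectral_iff [OF B] A by blast
  show ?thesis
    by (simp add: A det_spectral [OF B] c prod_pos)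
qed

lemma pos_def_midpoint:
  assumes "pos_def S" "pos_def T"
  shows "pos_def ((1/2) *\<^sub>R (S + T))"
  using assms
  by (auto simp: pos_def_def symmetric_mat_def matrix_vec_simps inner_add_right transpose_def
      vec_eq_iff add_pos_pos)

section \<open>Invariance of the three distances under extension\<close>

lemma frobenius_dist2_isometric_lift:
  assumes Q: "transpose Q ** Q = mat 1" and S: "symmetric_mat S" and T: "symmetric_mat T"
  shows "frobenius_dist2 (isometric_lift Q a S) (isometric_lift Q a T) = frobenius_dist2 S T"
proof -
  have "isometric_lift Q a S - isometric_lift Q a T
      = isometric_lift Q a S + (-1) *\<^sub>R isometric_lift Q a T"
    by simp
  also have "\<dots> = isometric_lift Q 0 (S - T)"
    unfolding isometric_lift_scaleR [OF Q] isometric_lift_add [OF Q] by simp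
  finally have "isometric_lift Q a S - isometric_lift Q a T = isometric_lift Q 0 (S - T)" .
  moreover have "symmetric_mat (S - T)"
    using S T by (simp add: symmetric_mat_def transpose_def vec_eq_iff)
  ultimately show ?thesis
    by (simp add: frobenius_dist2_def norm_isometric_lift_zero [OF Q])
qed

lemma airm_dist2_isometric_lift:
  assumes Q: "transpose Q ** Q = mat 1" and S: "pos_def S" and T: "pos_def T" and a: "0 < a"
  shows "airm_dist2 (isometric_lift Q a S) (isometric_lift Q a T) = airm_dist2 S T"
proof -
  define M where "M = mat_inv_sqrt S ** T ** mat_inv_sqrt S"
  have M: "pos_def M"
    unfolding M_def
    by (rule pos_def_congruence [OF T]) (rule pos_def_mat_inv_sqrt [OF S])+
  \<comment> \<open>On the complement the scalars multiply to (1 / sqrt a) a (1 / sqrt a) = 1, and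
    ln 1 = 0 makes the logarithm vanish there.\<close>
  have "mat_inv_sqrt (isometric_lift Q a S) ** isometric_lift Q a T ** mat_inv_sqrt (isometric_lift Q a S)
      = isometric_lift Q 1 M"
    using a by (simp add: mat_inv_sqrt_isometric_lift [OF Q S a] isometric_lift_mult [OF Q] M_def)
  then show ?thesis
    by (simp add: airm_dist2_def mat_log_isometric_lift [OF Q M] symmetric_mat_log [OF M]
        norm_isometric_lift_zero [OF Q] flip: M_def)
qed

lemma jbld_isometric_lift:
  fixes Q :: "real^'k^'d"
  assumes Q: "transpose Q ** Q = mat 1" and S: "pos_def S" and T: "pos_def T" and a: "0 < a"
  shows "jbld (isometric_lift Q a S) (isometric_lift Q a T) = jbld S T"
proof -
  define n where "n = CARD('d) - CARD('k)"
  have det_lift: "det (isometric_lift Q a A) = a ^ n * det A" if "pos_def A" for A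
    using that det_isometric_lift [OF Q] by (simp add: n_def pos_def_def)
  have "(1/2) *\<^sub>R (isometric_lift Q a S + isometric_lift Q a T) =
      isometric_lift Q a ((1/2) *\<^sub>R (S + T))"
    unfolding isometric_lift_add [OF Q] isometric_lift_scaleR [OF Q] by simp
  \<comment> \<open>The midpoint determinant contributes n ln a; the product of two determinants
    contributes 2 n ln a, which the factor 1/2 halves. Positivity of the determinants allows the
    logarithms to be split.\<close>
  then show ?thesis
    using a pos_def_det_pos [OF S] pos_def_det_pos [OF T] pos_def_det_pos [OF pos_def_midpoint [OF S T]]
    unfolding jbld_def det_mul
    by (simp add: det_lift S T pos_def_midpoint ln_mult_pos add_divide_distrib)
qed

section \<open>Covariance matrices\<close>

lemma column_matrix_mult: "column n (P ** A) = P *v column n A"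
  by (simp add: column_def matrix_matrix_mult_def matrix_vector_mult_def)

lemma col_mean_matrix_mult: "col_mean (P ** A) = P *v col_mean (A :: real^'m^'p)"
  by (simp add: col_mean_def column_matrix_mult matrix_vec_simps)

text \<open>Both terms of the covariance are outer products of vectors to which P is applied, so P
  factors out on either side.\<close>

lemma covariance_matrix_mult:
  fixes A :: "real^'m^'p" and P :: "real^'p^'q"
  shows "covariance (P ** A) = P ** covariance A ** transpose P"
  unfolding covariance_def column_matrix_mult col_mean_matrix_mult outer_product_matrix_mult matrix_eq
  by (simp add: matrix_vec_simps del: transpose_matrix_vector)

text \<open>The quadratic form at x is the variance of the numbers a_n \<bullet> x, nonnegative by
  Cauchy-Schwarz.\<close>

lemma inner_covariance_nonneg:
  fixes A :: "real^'m^'p"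
  shows "0 \<le> x \<bullet> (covariance A *v x)"
proof -
  let ?M = "real CARD('m)"
  let ?a = "\<lambda>n. column n A \<bullet> x"
  have "(\<Sum>n\<in>UNIV. ?a n)\<^sup>2 / ?M\<^sup>2 \<le> ((\<Sum>n\<in>UNIV. (?a n)\<^sup>2) * ?M) / ?M\<^sup>2"
    by (intro divide_right_mono sum_squared_le_sum_of_squares) simp
  also have "\<dots> = (\<Sum>n\<in>UNIV. (?a n)\<^sup>2) / ?M"
    by (simp add: power2_eq_square)
  finally have "((\<Sum>n\<in>UNIV. ?a n) / ?M)\<^sup>2 \<le> (\<Sum>n\<in>UNIV. (?a n)\<^sup>2) / ?M"
    by (simp add: power_divide)
  moreover have "x \<bullet> (covariance A *v x) =
      (\<Sum>n\<in>UNIV. (?a n)\<^sup>2) / ?M - ((\<Sum>n\<in>UNIV. ?a n) / ?M)\<^sup>2"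
    by (simp add: covariance_def col_mean_def matrix_vec_simps inner_diff_right inner_sum_right
        inner_sum_left inner_commute [of x] power2_eq_square)
  ultimately show ?thesis by simp
qed

lemma pos_def_reg_covariance:
  assumes "0 < \<epsilon>"
  shows "pos_def (reg_covariance \<epsilon> A)"
proof -
  have "symmetric_mat (reg_covariance \<epsilon> A)"
    by (simp add: symmetric_mat_def reg_covariance_def covariance_def transpose_def vec_eq_iff
        outer_product_def mat_def mult.commute)
  moreover have "0 < x \<bullet> (reg_covariance \<epsilon> A *v x)" if "x \<noteq> 0" for x
    using that assms inner_covariance_nonneg [of x A]
    by (simp add: reg_covariance_def matrix_vec_simps inner_add_right add_nonneg_pos)
  ultimately show ?thesis by (simp add: pos_def_def)
qed

text \<open>The regularising term splits as \<epsilon> Q Q^T + \<epsilon> (I - Q Q^T): the first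
  part joins Q \<Sigma>(A) Q^T, the second is the scalar part of the lift.\<close>

lemma reg_covariance_isometric_lift:
  assumes Q: "transpose Q ** Q = mat 1"
  shows "reg_covariance \<epsilon> (Q ** A) = isometric_lift Q \<epsilon> (reg_covariance \<epsilon> A)"
  unfolding reg_covariance_def isometric_lift_def covariance_matrix_mult matrix_eq
  by (simp add: matrix_vec_simps scaleR_diff_right del: transpose_matrix_vector)

section \<open>The projection\<close>

text \<open>Let R be the root of X^T X and R' its inverse. Symmetry of R' gives P^T = X R', and then
  X^T X = R R and R R' = R' R = I collapse all three products.\<close>

lemma proj_matrix_gram:
  assumes pd: "pos_def (transpose X ** X)"
  shows "proj_matrix X ** X = mat_sqrt (transpose X ** X)"
    and "proj_matrix X ** transpose (proj_matrix X) = mat 1"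
    and "transpose (proj_matrix X) ** (proj_matrix X ** X) = X"
proof -
  let ?G = "transpose X ** X"
  let ?R = "mat_sqrt ?G" and ?R' = "mat_inv_sqrt ?G"
  have RR: "?R ** ?R = ?G" by (rule pos_def_mat_sqrt(2) [OF pd])
  have RR': "?R ** ?R' = mat 1" by (rule pos_def_mat_inv_sqrt(2) [OF pd])
  then have R'R: "?R' ** ?R = mat 1" using matrix_left_right_inverse by blast
  have P_tr: "transpose (proj_matrix X) = X ** ?R'"
    using pos_def_mat_inv_sqrt(1) [OF pd]
    by (simp add: proj_matrix_def matrix_transpose_mul symmetric_mat_def)
  have "proj_matrix X ** X = ?R' ** (?R ** ?R)"
    by (simp add: proj_matrix_def RR matrix_mul_assoc)
  then show PX: "proj_matrix X ** X = ?R"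
    by (simp add: matrix_mul_assoc R'R)
  then show "proj_matrix X ** transpose (proj_matrix X) = mat 1"
    by (simp add: P_tr matrix_mul_assoc RR')
  show "transpose (proj_matrix X) ** (proj_matrix X ** X) = X"
    unfolding PX P_tr by (simp add: R'R flip: matrix_mul_assoc)
qed

lemma hconcat_matrix_mult: "M ** hconcat A B = hconcat (M ** A) (M ** B)"
  by (auto simp: hconcat_def matrix_matrix_mult_def vec_eq_iff split: sum.split)

text \<open>Serves to read the identity Q P X = X block by block.\<close>

lemma hconcat_inject: "hconcat A B = hconcat A' B' \<longleftrightarrow> A = A' \<and> B = B'"
proof
  assume eq: "hconcat A B = hconcat A' B'"
  have "A $ i $ k = A' $ i $ k" for i k
    using arg_cong [OF eq, of "\<lambda>M. M $ i $ Inl k"] by (simp add: hconcat_def)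
  moreover have "B $ i $ k = B' $ i $ k" for i k
    using arg_cong [OF eq, of "\<lambda>M. M $ i $ Inr k"] by (simp add: hconcat_def)
  ultimately show "A = A' \<and> B = B'" by (simp add: vec_eq_iff)
qed simp

theorem proposition3:
  fixes \<Phi> :: "real^'n^'d" and \<Phi>s :: "real^'m^'d" and X :: "real^('n + 'm)^'d"
  assumes X_eq: "X = hconcat \<Phi> \<Phi>s"
    and pd: "pos_def (transpose X ** X)"
  shows "proj X X = mat_sqrt (transpose X ** X)
    \<and> (\<forall>i j. norm (proj_matrix X *v column i X - proj_matrix X *v column j X)
               = norm (column i X - column j X))
    \<and> (\<forall>\<epsilon>>0.
           frobenius_dist2 (reg_covariance \<epsilon> \<Phi>) (reg_covariance \<epsilon> \<Phi>s)
             = frobenius_dist2 (reg_covariance \<epsilon> (proj X \<Phi>)) (reg_covariance \<epsilon> (proj X \<Phi>s))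
         \<and> airm_dist2 (reg_covariance \<epsilon> \<Phi>) (reg_covariance \<epsilon> \<Phi>s)
             = airm_dist2 (reg_covariance \<epsilon> (proj X \<Phi>)) (reg_covariance \<epsilon> (proj X \<Phi>s))
         \<and> jbld (reg_covariance \<epsilon> \<Phi>) (reg_covariance \<epsilon> \<Phi>s)
             = jbld (reg_covariance \<epsilon> (proj X \<Phi>)) (reg_covariance \<epsilon> (proj X \<Phi>s)))"
proof -
  define P where "P = proj_matrix X"
  define Q where "Q = transpose P"
  have PX: "P ** X = mat_sqrt (transpose X ** X)"
    and Q: "transpose Q ** Q = mat 1" and QPX: "Q ** (P ** X) = X"
    using proj_matrix_gram [OF pd] by (simp_all add: P_def Q_def)
  have "norm (P *v column i X - P *v column j X) = norm (column i X - column j X)" for i j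
  proof -
    let ?y = "column i X - column j X"
    have "Q *v (P *v column i X) = column i X" for i
      by (metis QPX column_matrix_mult)
    \<comment> \<open>Moving one P across the inner product leaves P^T P, which fixes differences of
      columns of X.\<close>
    then have "transpose P *v (P *v ?y) = ?y"
      by (simp add: matrix_vector_mult_diff_distrib Q_def del: transpose_matrix_vector)
    then have "(P *v ?y) \<bullet> (P *v ?y) = ?y \<bullet> ?y"
      by (metis inner_transpose_mult)
    then show ?thesis
      by (simp add: norm_eq matrix_vector_mult_diff_distrib)
  qed
  moreover have "Q ** (P ** \<Phi>) = \<Phi>" "Q ** (P ** \<Phi>s) = \<Phi>s"
    using QPX by (simp_all add: X_eq hconcat_matrix_mult hconcat_inject)
  \<comment> \<open>With \<Phi> written as Q (P \<Phi>), each covariance of size d is a lift of the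
    one of size d', so the left sides of (c) are rewritten into the right sides.\<close>
  then have lift: "reg_covariance \<epsilon> \<Phi> = isometric_lift Q \<epsilon> (reg_covariance \<epsilon> (P ** \<Phi>))"
    "reg_covariance \<epsilon> \<Phi>s = isometric_lift Q \<epsilon> (reg_covariance \<epsilon> (P ** \<Phi>s))" for \<epsilon>
    using reg_covariance_isometric_lift [OF Q] by metis+
  ultimately show ?thesis
    by (simp add: proj_def lift PX pos_def_reg_covariance pos_def_imp_symmetric frobenius_dist2_isometric_lift [OF Q]
        airm_dist2_isometric_lift [OF Q] jbld_isometric_lift [OF Q] flip: P_def)
qed

end
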